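(* Let $G$ be a connected graph of order $n_1\ge 2$ and let $H$ be a connected graph of order $n_2\ge 7$. If $D(H)\ge 6$ or $H$ is a cycle graph, then for every integer $k\ge 1$, $$\dim(G\odot^k H)=n_1(n_2+1)^{k-1}\dim(K_1\odot H).$$
   Context: All graphs are finite and simple. For a connected graph $\Gamma$, $d(u,v)$ is the length of a shortest path between $u$ and $v$, and the diameter is $D(\Gamma)=\max_{u,v}d(u,v)$. For a set $S=\{v_1,\dots,v_m\}$ of vertices of a connected graph $\Gamma$, the metric representation of a vertex $v$ is $r(v|S)=(d(v,v_1),\dots,d(v,v_m))$. $S$ is a resolving set for $\Gamma$ if $r(u|S)\ne r(v|S)$ for every pair of distinct vertices $u,v$ of $\Gamma$. The metric dimension $\dim(\Gamma)$ is the minimum cardinality of a resolving set for $\Gamma$. For graphs $G$ and $H$ with $G$ of order $n_1$, the corona product $G\odot H$ is obtained by taking one copy of $G$ and $n_1$ disjoint copies of $H$ and joining by an edge each vertex of the $i$-th copy of $H$ with the $i$-th vertex of $G$. In particular, with $K_1$ the one-vertex graph, $K_1\odot H$ is the join $K_1+H$, i.e. $H$ together with one new vertex adjacent to all vertices of $H$. Set $G\odot^1 H=G\odot H$ and, for $k\ge 2$, $G\odot^k H=(G\odot^{k-1}H)\odot H$. *)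

theory Defs
  imports Graph_Theory.Graph_Theory "HOL-Library.FuncSet"
begin

text \<open>
  Finite simple graphs are values of type \<^typ>\<open>'a pair_pre_digraph\<close> satisfying
  \<^locale>\<open>pair_graph\<close>: finitely many vertices, and a symmetric irreflexive set of arcs, so that
  an edge \<open>uv\<close> is the pair of arcs \<open>(u, v)\<close>, \<open>(v, u)\<close>.
\<close>

definition gdist :: "'a pair_pre_digraph \<Rightarrow> 'a \<Rightarrow> 'a \<Rightarrow> nat" where
  "gdist G u v = (LEAST n. \<exists>p. pre_digraph.apath (with_proj G) u p v \<and> length p = n)"

definition diameter :: "'a pair_pre_digraph \<Rightarrow> nat" where
  "diameter G = Max {gdist G u v | u v. u \<in> pverts G \<and> v \<in> pverts G}"

text \<open>
  The vector of distances to the elements of \<open>S\<close> is indexed by \<open>S\<close> itself instead of by an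
  enumeration of \<open>S\<close>.
\<close>
definition metric_rep :: "'a pair_pre_digraph \<Rightarrow> 'a set \<Rightarrow> 'a \<Rightarrow> 'a \<Rightarrow> nat" where
  "metric_rep G S v = (\<lambda>s\<in>S. gdist G v s)"

definition resolving_set :: "'a pair_pre_digraph \<Rightarrow> 'a set \<Rightarrow> bool" where
  "resolving_set G S \<longleftrightarrow> S \<subseteq> pverts G \<and>
    (\<forall>u \<in> pverts G. \<forall>v \<in> pverts G. u \<noteq> v \<longrightarrow> metric_rep G S u \<noteq> metric_rep G S v)"

definition metric_dim :: "'a pair_pre_digraph \<Rightarrow> nat" where
  "metric_dim G = (LEAST m. \<exists>S. resolving_set G S \<and> card S = m)"

definition cycle_graph :: "nat \<Rightarrow> nat pair_pre_digraph" where
  "cycle_graph n = \<lparr> pverts = {..<n},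
     parcs = {(i, j). i < n \<and> j < n \<and> (j = (i + 1) mod n \<or> i = (j + 1) mod n)} \<rparr>"

definition is_cycle_graph :: "'a pair_pre_digraph \<Rightarrow> bool" where
  "is_cycle_graph H \<longleftrightarrow>
    (\<exists>n\<ge>3. digraph_iso (with_proj H) (with_proj (cycle_graph n)))"

definition K1 :: "unit pair_pre_digraph" where
  "K1 = \<lparr> pverts = {()}, parcs = {} \<rparr>"

text \<open>
  \<open>(v, None)\<close> is the vertex \<open>v\<close> of \<open>G\<close>, and \<open>(v, Some x)\<close> is the vertex \<open>x\<close> of the copy of \<open>H\<close>
  attached to \<open>v\<close>.
\<close>
definition corona ::
    "'a pair_pre_digraph \<Rightarrow> 'b pair_pre_digraph \<Rightarrow> ('a \<times> 'b option) pair_pre_digraph" where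
  "corona G H =
    \<lparr> pverts = {(v, None) | v. v \<in> pverts G} \<union> {(v, Some x) | v x. v \<in> pverts G \<and> x \<in> pverts H},
      parcs = {((u, None), (v, None)) | u v. (u, v) \<in> parcs G}
        \<union> {((v, Some x), (v, Some y)) | v x y. v \<in> pverts G \<and> (x, y) \<in> parcs H}
        \<union> {((v, None), (v, Some x)) | v x. v \<in> pverts G \<and> x \<in> pverts H}
        \<union> {((v, Some x), (v, None)) | v x. v \<in> pverts G \<and> x \<in> pverts H} \<rparr>"

definition relabel :: "('a \<Rightarrow> 'b) \<Rightarrow> 'a pair_pre_digraph \<Rightarrow> 'b pair_pre_digraph" where
  "relabel f G = \<lparr> pverts = f ` pverts G, parcs = map_prod f f ` parcs G \<rparr>"

text \<open>
  The vertex type of \<^const>\<open>corona\<close> grows with each application, so the vertices of the iterate are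
  injectively renamed at each step: the list records the second components, the latest one first.
  Index \<open>0\<close> is \<open>G\<close> itself up to renaming; \<open>corona_iter_1_iso\<close> and \<open>corona_iter_Suc_iso\<close> below
  give the usual recursion, which starts from index \<open>1\<close>.
\<close>
primrec corona_iter ::
    "nat \<Rightarrow> 'a pair_pre_digraph \<Rightarrow> 'b pair_pre_digraph \<Rightarrow> ('a \<times> 'b option list) pair_pre_digraph"
where
  "corona_iter 0 G H = relabel (\<lambda>v. (v, [])) G"
| "corona_iter (Suc k) G H = relabel (\<lambda>((v, xs), x). (v, x # xs)) (corona (corona_iter k G H) H)"

lemma pair_graph_iff:
  "pair_graph G \<longleftrightarrow> finite (pverts G) \<and> parcs G \<subseteq> pverts G \<times> pverts G \<and> sym (parcs G) \<and> irrefl (parcs G)"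
proof
  assume "pair_graph G"
  then interpret pair_graph G .
  show "finite (pverts G) \<and> parcs G \<subseteq> pverts G \<times> pverts G \<and> sym (parcs G) \<and> irrefl (parcs G)"
    using pair_finite_verts wellformed' pair_no_loops pair_sym_arcs
    by (fastforce simp: symmetric_def irrefl_def)
next
  assume A: "finite (pverts G) \<and> parcs G \<subseteq> pverts G \<times> pverts G \<and> sym (parcs G) \<and> irrefl (parcs G)"
  then have "finite (parcs G)"
    by (meson finite_SigmaI finite_subset)
  with A show "pair_graph G"
    by unfold_locales (auto simp: symmetric_def irrefl_def)
qed

lemma pair_graph_relabel:
  assumes "pair_graph G" "inj f"
  shows "pair_graph (relabel f G)"
  using assms unfolding pair_graph_iff relabel_def
  by (fastforce simp: sym_def irrefl_def inj_eq)

lemma pair_graph_corona: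
  assumes "pair_graph G" "pair_graph H"
  shows "pair_graph (corona G H)"
proof -
  have "pverts (corona G H) \<subseteq> pverts G \<times> insert None (Some ` pverts H)"
    by (auto simp: corona_def)
  then have "finite (pverts (corona G H))"
    using assms by (auto simp: pair_graph_iff intro: finite_subset)
  then show ?thesis
    using assms unfolding pair_graph_iff by (auto simp: corona_def sym_def irrefl_def)
qed

lemma inj_corona_iter_rename: "inj (\<lambda>((v, xs), x). (v, x # xs))"
  by (auto simp: inj_def)

lemma pair_graph_corona_iter:
  assumes "pair_graph G" "pair_graph H"
  shows "pair_graph (corona_iter k G H)"
  using assms
  by (induction k) (auto intro!: pair_graph_relabel pair_graph_corona inj_corona_iter_rename simp: inj_def)

lemma digraph_iso_relabel:
  assumes "pair_graph G" "inj f"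
  shows "digraph_iso (with_proj G) (with_proj (relabel f G))"
proof -
  interpret pair_graph G by fact
  let ?h = "\<lparr> iso_verts = f, iso_arcs = map_prod f f, iso_head = snd, iso_tail = fst \<rparr>"
  have "inj (map_prod f f)"
    using assms(2) by (simp add: prod.inj_map)
  then have "pre_digraph.digraph_isomorphism (with_proj G) ?h"
    using assms(2) wf_digraph unfolding pre_digraph.digraph_isomorphism_def
    by (auto simp: inj_on_subset[OF _ subset_UNIV])
  moreover have "with_proj (relabel f G) = app_iso ?h (with_proj G)"
    by (simp add: app_iso_def with_proj_def relabel_def)
  ultimately show ?thesis
    unfolding digraph_iso_def by blast
qed

lemma relabel_relabel: "relabel f (relabel g G) = relabel (f \<circ> g) G"
  by (simp add: relabel_def image_image map_prod_def case_prod_unfold)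

lemma corona_conv_images:
  "corona G H =
    \<lparr> pverts = (\<lambda>v. (v, None)) ` pverts G \<union> (\<lambda>(v, x). (v, Some x)) ` (pverts G \<times> pverts H),
      parcs = (\<lambda>(u, v). ((u, None), (v, None))) ` parcs G
        \<union> (\<lambda>(v, x, y). ((v, Some x), (v, Some y))) ` (pverts G \<times> parcs H)
        \<union> (\<lambda>(v, x). ((v, None), (v, Some x))) ` (pverts G \<times> pverts H)
        \<union> (\<lambda>(v, x). ((v, Some x), (v, None))) ` (pverts G \<times> pverts H) \<rparr>"
  unfolding corona_def by (force simp: image_def)

lemma image_times_left: "f ` A \<times> B = map_prod f id ` (A \<times> B)"
  by force

lemma corona_relabel: "corona (relabel f G) H = relabel (map_prod f id) (corona G H)"
  unfolding corona_conv_images relabel_def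
  by (simp add: image_Un image_image image_times_left case_prod_unfold)

lemma corona_iter_1_iso:
  assumes "pair_graph G" "pair_graph H"
  shows "digraph_iso (with_proj (corona G H)) (with_proj (corona_iter 1 G H))"
proof -
  let ?f = "(\<lambda>((v, xs), x). (v, x # xs)) \<circ> map_prod (\<lambda>v. (v, [])) id"
  have "corona_iter 1 G H = relabel ?f (corona G H)"
    by (simp add: corona_relabel relabel_relabel)
  moreover have "inj ?f"
    by (auto simp: inj_def)
  ultimately show ?thesis
    using digraph_iso_relabel[OF pair_graph_corona[OF assms]] by metis
qed

lemma corona_iter_Suc_iso:
  assumes "pair_graph G" "pair_graph H"
  shows "digraph_iso (with_proj (corona (corona_iter k G H) H)) (with_proj (corona_iter (Suc k) G H))"
  using digraph_iso_relabel[OF pair_graph_corona[OF pair_graph_corona_iter[OF assms] assms(2)] inj_corona_iter_rename]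
  by simp

end

theory Submission
  imports Defs
begin

text \<open>
  Vertices outside a copy of \<open>H\<close> are equidistant from all its vertices, and inside the copy distances
  are truncated at \<open>2\<close>. So a resolving set of \<open>G \<odot> H\<close> must meet every copy in a set that
  separates the vertices of \<open>H\<close> by the truncated distance. Conversely, such sets, one in each copy,
  resolve \<open>G \<odot> H\<close>, provided none of them is contained in the neighbourhood of a single vertex
  \<open>x\<close>. If one were, all vertices but at most one would be within distance \<open>2\<close> of \<open>x\<close>, and that one
  within distance \<open>3\<close>, so the diameter would be at most \<open>5\<close>; and with all degrees at most \<open>2\<close> there
  would be at most \<open>6\<close> vertices. Hence \<open>dim (G \<odot> H)\<close> is the order of \<open>G\<close> times a constant depending
  on \<open>H\<close> only, which the case \<open>G = K\<^sub>1\<close> identifies.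
\<close>

section \<open>Distances as lengths of walks\<close>

lemma relpow_imp_awalk:
  assumes "pair_graph G" "u \<in> pverts G" "(u, v) \<in> parcs G ^^ n"
  shows "\<exists>p. pre_digraph.awalk (with_proj G) u p v \<and> length p = n"
proof -
  interpret pair_graph G by fact
  show ?thesis
    using assms(2,3)
  proof (induction n arbitrary: u)
    case 0
    then show ?case by (auto simp: awalk_Nil_iff)
  next
    case (Suc n)
    then obtain w where w: "(u, w) \<in> parcs G" "(w, v) \<in> parcs G ^^ n"
      by (blast elim: relpow_Suc_E2)
    then obtain p where "awalk w p v" "length p = n"
      using Suc.IH[of w] wellformed'(2) by fastforce
    with w have "awalk u ((u, w) # p) v" "length ((u, w) # p) = Suc n"
      by (auto simp: awalk_Cons_iff)
    then show ?case by blast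
  qed
qed

lemma awalk_imp_relpow:
  assumes "pair_graph G" "pre_digraph.awalk (with_proj G) u p v"
  shows "(u, v) \<in> parcs G ^^ length p"
proof -
  interpret pair_graph G by fact
  show ?thesis
    using assms(2)
  proof (induction p arbitrary: u)
    case Nil
    then show ?case by (auto simp: awalk_Nil_iff)
  next
    case (Cons a p)
    then show ?case
      by (cases a) (auto simp: awalk_Cons_iff simp del: relpow.simps intro: relpow_Suc_I2)
  qed
qed

text \<open>Cutting out cycles only keeps arcs of \<open>p\<close>, and a path repeats no arc, so
  its length is at most the number of distinct arcs of \<open>p\<close>.\<close>

lemma awalk_imp_short_apath:
  assumes "pair_graph G" "pre_digraph.awalk (with_proj G) u p v"
  shows "\<exists>q. pre_digraph.apath (with_proj G) u q v \<and> length q \<le> length p"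
proof -
  interpret pair_graph G by fact
  let ?q = "awalk_to_apath p"
  have q: "apath u ?q v"
    using assms(2) by (rule apath_awalk_to_apath)
  then have "distinct ?q"
    by (auto simp: apath_def intro: distinct_verts_imp_distinct)
  then have "length ?q = card (set ?q)"
    by (simp add: distinct_card)
  also have "\<dots> \<le> card (set p)"
    using awalk_to_apath_subset[OF assms(2)] by (intro card_mono) auto
  also have "\<dots> \<le> length p" by (rule card_length)
  finally show ?thesis using q by blast
qed

text \<open>A shortest walk is already a path, so distances can be handled through powers of the arc
  relation, which compose and reverse more easily than paths.\<close>

lemma gdist_eq_relpow:
  assumes "pair_graph G" "u \<in> pverts G"
  shows "gdist G u v = (LEAST n. (u, v) \<in> parcs G ^^ n)"
proof -
  interpret pair_graph G by fact
  let ?P = "\<lambda>n. \<exists>p. apath u p v \<and> length p = n" and ?Q = "\<lambda>n. (u, v) \<in> parcs G ^^ n"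
  have PQ: "?Q n" if "?P n" for n
    using that awalk_imp_relpow[OF assms(1)] awalkI_apath by blast
  have QP: "\<exists>m\<le>n. ?P m" if "?Q n" for n
    using relpow_imp_awalk[OF assms that] awalk_imp_short_apath[OF assms(1)] by blast
  show ?thesis
  proof (cases "\<exists>n. ?Q n")
    case True
    then have Q: "?Q (Least ?Q)" by (auto intro: LeastI_ex)
    then obtain m where m: "m \<le> Least ?Q" "?P m" using QP by blast
    then have "Least ?Q \<le> m" using PQ by (blast intro: Least_le)
    with m have "?P (Least ?Q)" by simp
    then show ?thesis
      unfolding gdist_def by (intro Least_equality) (blast intro: Least_le PQ)+
  next
    \<comment> \<open>Without any walk both predicates are false everywhere, so the two unspecified
      \<open>LEAST\<close> values coincide.\<close>
    case False
    then have "?P n \<longleftrightarrow> ?Q n" for n using PQ by blast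
    then show ?thesis unfolding gdist_def by simp
  qed
qed

lemma gdist_le:
  assumes "pair_graph G" "u \<in> pverts G" "(u, v) \<in> parcs G ^^ n"
  shows "gdist G u v \<le> n"
  using assms by (simp add: gdist_eq_relpow Least_le)

lemma connected_iff_relpow:
  assumes "pair_graph G"
  shows "connected (with_proj G) \<longleftrightarrow>
    pverts G \<noteq> {} \<and> (\<forall>u\<in>pverts G. \<forall>v\<in>pverts G. \<exists>n. (u, v) \<in> parcs G ^^ n)"
proof -
  interpret pair_graph G by fact
  \<comment> \<open>Connectedness is strong connectedness of the symmetric closure, which here is
    the graph itself.\<close>
  have "mk_symmetric (with_proj G) = G"
    using assms unfolding pair_graph_iff mk_symmetric_def
    by (intro pair_pre_digraph.equality) (auto dest: symD)
  moreover have "u \<rightarrow>\<^sup>*\<^bsub>with_proj G\<^esub> v \<longleftrightarrow> (\<exists>n. (u, v) \<in> parcs G ^^ n)"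
    if "u \<in> pverts G" for u v
    using relpow_imp_awalk[OF assms that] awalk_imp_relpow[OF assms]
    unfolding reachable_awalk by blast
  ultimately show ?thesis
    by (auto simp: connected_def strongly_connected_def)
qed

lemma relpow_gdist:
  assumes "pair_graph G" "connected (with_proj G)" "u \<in> pverts G" "v \<in> pverts G"
  shows "(u, v) \<in> parcs G ^^ gdist G u v"
  using assms by (auto simp: gdist_eq_relpow connected_iff_relpow intro: LeastI_ex)

lemma gdist_self [simp]:
  assumes "pair_graph G" "u \<in> pverts G"
  shows "gdist G u u = 0"
  using gdist_le[OF assms, of u 0] by simp

lemma relpow_sym:
  assumes "sym R" "(x, y) \<in> R ^^ n"
  shows "(y, x) \<in> R ^^ n"
  using assms(2)
proof (induction n arbitrary: y)
  case (Suc n)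
  then show ?case using assms(1) by (blast elim: relpow_Suc_E intro: relpow_Suc_I2 dest: symD)
qed auto

lemma gdist_triangle:
  assumes "pair_graph G" "connected (with_proj G)"
    and "u \<in> pverts G" "v \<in> pverts G" "w \<in> pverts G"
  shows "gdist G u w \<le> gdist G u v + gdist G v w"
  using assms
  by (intro gdist_le) (auto simp: relpow_add intro: relpow_gdist)

lemma gdist_commute:
  assumes "pair_graph G" "connected (with_proj G)" "u \<in> pverts G" "v \<in> pverts G"
  shows "gdist G u v = gdist G v u"
  using assms
  by (intro antisym gdist_le relpow_sym[OF _ relpow_gdist]) (auto simp: pair_graph_iff)

lemma gdist_arc_le:
  assumes "pair_graph G" "connected (with_proj G)" "(u, v) \<in> parcs G" "t \<in> pverts G"
  shows "gdist G u t \<le> Suc (gdist G v t)"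
  using assms
  by (intro gdist_le relpow_Suc_I2[OF assms(3)] relpow_gdist) (auto simp: pair_graph_iff)

text \<open>The witness is the second vertex of a shortest walk from \<open>u\<close> to
  \<open>t\<close>.\<close>

lemma gdist_descent:
  assumes "pair_graph G" "connected (with_proj G)" "u \<in> pverts G" "t \<in> pverts G" "u \<noteq> t"
  shows "\<exists>v. (u, v) \<in> parcs G \<and> gdist G u t = Suc (gdist G v t)"
proof -
  obtain n where n: "gdist G u t = Suc n"
    using relpow_gdist[OF assms(1-4)] assms(5) by (cases "gdist G u t") auto
  then obtain v where v: "(u, v) \<in> parcs G" "(v, t) \<in> parcs G ^^ n"
    using relpow_gdist[OF assms(1-4)] by (metis relpow_Suc_D2)
  then have "gdist G v t \<le> n"
    using assms(1) by (intro gdist_le) (auto simp: pair_graph_iff)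
  with n v gdist_arc_le[OF assms(1,2) v(1) assms(4)] show ?thesis by force
qed

text \<open>Follow arcs along which \<open>f\<close> drops by one. A vertex of value
  \<open>0\<close> allows no further drop, so it must be \<open>t\<close>.\<close>

lemma potential_relpow:
  fixes f :: "'a \<Rightarrow> nat"
  assumes "pair_graph G"
    and "\<And>x. x \<in> pverts G \<Longrightarrow> x \<noteq> t \<Longrightarrow> \<exists>y. (x, y) \<in> parcs G \<and> f x = Suc (f y)"
    and "f t = 0" "u \<in> pverts G"
  shows "(u, t) \<in> parcs G ^^ f u"
  using assms(4)
proof (induction "f u" arbitrary: u)
  case 0
  then show ?case using assms(2)[of u] by fastforce
next
  case (Suc n)
  then have "u \<noteq> t" using assms(3) by auto
  then obtain y where y: "(u, y) \<in> parcs G" "f u = Suc (f y)"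
    using assms(2) Suc.prems by blast
  then have "y \<in> pverts G" using assms(1) by (auto simp: pair_graph_iff)
  then have "(y, t) \<in> parcs G ^^ f y" using Suc y by simp
  then show ?case using y by (metis relpow_Suc_I2)
qed

text \<open>A certificate for a guessed distance function: descent provides a walk of length
  \<open>f u\<close>, and since \<open>f\<close> drops by at most one along any arc, no walk to
  \<open>t\<close> is shorter.\<close>

lemma gdist_eqI:
  fixes f :: "'a \<Rightarrow> nat"
  assumes "pair_graph G"
    and "\<And>x. x \<in> pverts G \<Longrightarrow> x \<noteq> t \<Longrightarrow> \<exists>y. (x, y) \<in> parcs G \<and> f x = Suc (f y)"
    and "\<And>x y. (x, y) \<in> parcs G \<Longrightarrow> f x \<le> Suc (f y)"
    and "f t = 0" "u \<in> pverts G"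
  shows "gdist G u t = f u"
proof (rule antisym)
  show "gdist G u t \<le> f u"
    using assms potential_relpow[of G t f u] by (intro gdist_le) auto
  have le: "f x \<le> n" if "(x, t) \<in> parcs G ^^ n" for x n
    using that
  proof (induction n arbitrary: x)
    case (Suc n)
    then obtain y where "(x, y) \<in> parcs G" "(y, t) \<in> parcs G ^^ n"
      by (blast elim: relpow_Suc_E2)
    then show ?case using Suc.IH[of y] assms(3)[of x y] by simp
  qed (use assms(4) in auto)
  have "(u, t) \<in> parcs G ^^ f u"
    using assms potential_relpow[of G t f u] by auto
  then have "(u, t) \<in> parcs G ^^ gdist G u t"
    unfolding gdist_eq_relpow[OF assms(1,5)] by (rule LeastI)
  then show "f u \<le> gdist G u t" by (rule le)
qed

lemma resolving_set_iff:
  "resolving_set G S \<longleftrightarrow> S \<subseteq> pverts G \<and>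
    (\<forall>u\<in>pverts G. \<forall>v\<in>pverts G. u \<noteq> v \<longrightarrow> (\<exists>s\<in>S. gdist G u s \<noteq> gdist G v s))"
proof -
  have "metric_rep G S u = metric_rep G S v \<longleftrightarrow> (\<forall>s\<in>S. gdist G u s = gdist G v s)" for u v
    unfolding metric_rep_def restrict_def fun_eq_iff by auto
  then show ?thesis unfolding resolving_set_def by simp
qed

section \<open>Relabelling\<close>

lemma relpow_relabel:
  assumes "inj f"
  shows "(f u, f v) \<in> parcs (relabel f G) ^^ n \<longleftrightarrow> (u, v) \<in> parcs G ^^ n"
proof (induction n arbitrary: v)
  case 0
  then show ?case using assms by (auto dest: injD)
next
  case (Suc n)
  have arc: "(x, f v) \<in> parcs (relabel f G) \<longleftrightarrow> (\<exists>w. x = f w \<and> (w, v) \<in> parcs G)" for x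
    using assms by (force simp: relabel_def dest: injD)
  have "(f u, f v) \<in> parcs (relabel f G) ^^ Suc n \<longleftrightarrow>
      (\<exists>w. (f u, f w) \<in> parcs (relabel f G) ^^ n \<and> (w, v) \<in> parcs G)"
    using arc by (auto simp: relcomp_unfold)
  then show ?case by (auto simp: Suc.IH)
qed

lemma gdist_relabel:
  assumes "pair_graph G" "inj f" "u \<in> pverts G"
  shows "gdist (relabel f G) (f u) (f v) = gdist G u v"
proof -
  have "f u \<in> pverts (relabel f G)" using assms by (simp add: relabel_def)
  then show ?thesis
    using assms by (simp add: gdist_eq_relpow pair_graph_relabel relpow_relabel)
qed

lemma connected_relabel:
  assumes "pair_graph G" "inj f" "connected (with_proj G)"
  shows "connected (with_proj (relabel f G))"
proof -
  have "pverts (relabel f G) = f ` pverts G" by (simp add: relabel_def)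
  then show ?thesis
    using assms by (simp add: connected_iff_relpow pair_graph_relabel relpow_relabel)
qed

lemma resolving_set_relabel:
  assumes "pair_graph G" "inj f"
  shows "resolving_set (relabel f G) (f ` S) \<longleftrightarrow> resolving_set G S"
proof -
  have "pverts (relabel f G) = f ` pverts G" by (simp add: relabel_def)
  then show ?thesis
    using assms by (simp add: resolving_set_iff gdist_relabel inj_image_subset_iff inj_eq cong: ball_cong)
qed

text \<open>Each iterate is a corona product only up to renaming. A resolving set of the renamed
  graph lies in the range of \<open>f\<close> on the vertices, hence is the image of a set of the
  same size.\<close>

lemma metric_dim_relabel:
  assumes "pair_graph G" "inj f"
  shows "metric_dim (relabel f G) = metric_dim G"
proof -
  have "(\<exists>S. resolving_set (relabel f G) S \<and> card S = m) \<longleftrightarrow> (\<exists>S. resolving_set G S \<and> card S = m)"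
    (is "?L \<longleftrightarrow> ?R") for m
  proof
    assume ?L
    then obtain S where S: "resolving_set (relabel f G) S" "card S = m" by blast
    then have "S \<subseteq> f ` pverts G" by (simp add: resolving_set_def relabel_def)
    then obtain T where "S = f ` T" by (auto simp: subset_image_iff)
    with S assms show ?R
      by (metis resolving_set_relabel card_image inj_on_subset subset_UNIV)
  next
    assume ?R
    then show ?L
      using assms by (metis resolving_set_relabel card_image inj_on_subset subset_UNIV)
  qed
  then show ?thesis unfolding metric_dim_def by presburger
qed

section \<open>Corona products\<close>

text \<open>The distance between two vertices of the same copy of \<open>H\<close> in a corona product: a path through
  the attached vertex has length \<open>2\<close>.\<close>

definition adist :: "'b pair_pre_digraph \<Rightarrow> 'b \<Rightarrow> 'b \<Rightarrow> nat" where
  "adist H x y = (if x = y then 0 else if (x, y) \<in> parcs H then 1 else 2)"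

text \<open>Known as an adjacency generator of \<open>H\<close>; the minimum size
  \<open>adj_dim\<close> is the adjacency dimension.\<close>

definition adj_resolving :: "'b pair_pre_digraph \<Rightarrow> 'b set \<Rightarrow> bool" where
  "adj_resolving H S \<longleftrightarrow> S \<subseteq> pverts H \<and>
    (\<forall>x\<in>pverts H. \<forall>y\<in>pverts H. x \<noteq> y \<longrightarrow> (\<exists>s\<in>S. adist H x s \<noteq> adist H y s))"

definition adj_dim :: "'b pair_pre_digraph \<Rightarrow> nat" where
  "adj_dim H = (LEAST m. \<exists>S. adj_resolving H S \<and> card S = m)"

lemma pverts_corona:
  "pverts (corona G H) = pverts G \<times> insert None (Some ` pverts H)"
  by (auto simp: corona_def)

lemma card_pverts_corona:
  assumes "pair_graph H"
  shows "card (pverts (corona G H)) = card (pverts G) * (card (pverts H) + 1)"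
proof -
  have "card (insert None (Some ` pverts H)) = card (pverts H) + 1"
    using assms by (subst card_insert_disjoint) (auto simp: pair_graph_iff card_image)
  then show ?thesis by (simp add: pverts_corona card_cartesian_product)
qed

lemma corona_arc_iff:
  "((u, a), (v, b)) \<in> parcs (corona G H) \<longleftrightarrow>
    (case (a, b) of
      (None, None) \<Rightarrow> (u, v) \<in> parcs G
    | (Some x, Some y) \<Rightarrow> u = v \<and> u \<in> pverts G \<and> (x, y) \<in> parcs H
    | (None, Some y) \<Rightarrow> u = v \<and> u \<in> pverts G \<and> y \<in> pverts H
    | (Some x, None) \<Rightarrow> u = v \<and> u \<in> pverts G \<and> x \<in> pverts H)"
  by (auto simp: corona_def split: option.splits)

section \<open>Distances and resolving sets in a corona product\<close>

context
  fixes G :: "'a pair_pre_digraph" and H :: "'b pair_pre_digraph"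
  assumes G: "pair_graph G" "connected (with_proj G)" and H: "pair_graph H"
begin

text \<open>A vertex of a copy first steps to its hub and then moves inside \<open>G\<close>. The
  walk is stated separately because it serves to prove the corona product connected.\<close>

lemma corona_hub_relpow_gdist:
  assumes "i \<in> pverts G" "(v, a) \<in> pverts (corona G H)"
  shows "((v, a), (i, None)) \<in> parcs (corona G H) ^^ (gdist G v i + (if a = None then 0 else 1))"
    and "gdist (corona G H) (v, a) (i, None) = gdist G v i + (if a = None then 0 else 1)"
proof -
  let ?f = "\<lambda>(v, a). gdist G v i + (if a = None then 0 else 1 :: nat)"
  have C: "pair_graph (corona G H)" using G H by (intro pair_graph_corona)
  have desc: "\<exists>y. (x, y) \<in> parcs (corona G H) \<and> ?f x = Suc (?f y)"
    if x: "x \<in> pverts (corona G H)" "x \<noteq> (i, None)" for x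
  proof (cases "snd x")
    case None
    then obtain v where "x = (v, None)" by (cases x) auto
    moreover from this x have "v \<in> pverts G" "v \<noteq> i" by (auto simp: pverts_corona)
    then obtain w where "(v, w) \<in> parcs G" "gdist G v i = Suc (gdist G w i)"
      using gdist_descent[OF G _ assms(1)] by blast
    ultimately show ?thesis by (intro exI[of _ "(w, None)"]) (auto simp: corona_arc_iff)
  next
    case (Some z)
    then have "x = (fst x, Some z)" by (cases x) auto
    with x show ?thesis
      by (intro exI[of _ "(fst x, None)"]) (cases x, auto simp: corona_arc_iff pverts_corona)
  qed
  have arc: "?f x \<le> Suc (?f y)" if "(x, y) \<in> parcs (corona G H)" for x y
    using that gdist_arc_le[OF G _ assms(1)]
    by (cases x; cases y) (auto simp: corona_arc_iff split: option.splits if_splits)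
  have 0: "?f (i, None) = 0" using G assms by simp
  show "((v, a), (i, None)) \<in> parcs (corona G H) ^^ (gdist G v i + (if a = None then 0 else 1))"
    using potential_relpow[of _ _ ?f, OF C desc 0 assms(2)] by simp
  show "gdist (corona G H) (v, a) (i, None) = gdist G v i + (if a = None then 0 else 1)"
    using gdist_eqI[of _ _ ?f, OF C desc arc 0 assms(2)] by simp
qed

text \<open>From outside, the copy at \<open>i\<close> is entered only through its hub, which is
  adjacent to all of it, so the distance does not depend on \<open>y\<close>. Inside the copy, the
  detour through the hub caps distances at \<open>2\<close>.\<close>

lemma gdist_corona_copy:
  assumes "i \<in> pverts G" "y \<in> pverts H" "(v, a) \<in> pverts (corona G H)"
  shows "gdist (corona G H) (v, a) (i, Some y) =
    (case a of None \<Rightarrow> gdist G v i + 1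
     | Some x \<Rightarrow> if v = i then adist H x y else gdist G v i + 2)"
proof -
  let ?f = "\<lambda>(v, a). case a of None \<Rightarrow> gdist G v i + 1
     | Some x \<Rightarrow> if v = i then adist H x y else gdist G v i + 2"
  have C: "pair_graph (corona G H)" using G H by (intro pair_graph_corona)
  have loop: "(y, y) \<notin> parcs H" using H by (auto simp: pair_graph_iff irrefl_def)
  have sym: "(p, q) \<in> parcs H \<Longrightarrow> (q, p) \<in> parcs H" for p q
    using H by (auto simp: pair_graph_iff dest: symD)
  have desc: "\<exists>w. (x, w) \<in> parcs (corona G H) \<and> ?f x = Suc (?f w)"
    if x: "x \<in> pverts (corona G H)" "x \<noteq> (i, Some y)" for x
  proof (cases "snd x")
    case None
    then obtain v where v: "x = (v, None)" by (cases x) auto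
    then have "v \<in> pverts G" using x by (auto simp: pverts_corona)
    show ?thesis
    proof (cases "v = i")
      case True
      then show ?thesis
        using v assms G
        by (intro exI[of _ "(i, Some y)"]) (auto simp: corona_arc_iff adist_def)
    next
      case False
      then obtain w where "(v, w) \<in> parcs G" "gdist G v i = Suc (gdist G w i)"
        using gdist_descent[OF G \<open>v \<in> pverts G\<close> assms(1)] by blast
      then show ?thesis using v by (intro exI[of _ "(w, None)"]) (auto simp: corona_arc_iff)
    qed
  next
    case (Some z)
    then obtain v where v: "x = (v, Some z)" by (cases x) auto
    then have vz: "v \<in> pverts G" "z \<in> pverts H" using x by (auto simp: pverts_corona)
    show ?thesis
    proof (cases "v = i \<and> (z, y) \<in> parcs H")
      case True
      then show ?thesis
        using v x vz loop
        by (intro exI[of _ "(i, Some y)"]) (auto simp: corona_arc_iff adist_def)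
    next
      \<comment> \<open>All remaining copy vertices descend to their own hub; in the copy at
        \<open>i\<close> the value drops from \<open>2\<close> to \<open>1\<close>.\<close>
      case False
      then show ?thesis
        using v x vz G
        by (intro exI[of _ "(v, None)"]) (auto simp: corona_arc_iff adist_def)
    qed
  qed
  have arc: "?f x \<le> Suc (?f w)" if "(x, w) \<in> parcs (corona G H)" for x w
    using that gdist_arc_le[OF G _ assms(1)] G assms sym
    by (cases x; cases w) (auto simp: corona_arc_iff adist_def split: option.splits if_splits)
  have "?f (i, Some y) = 0" by (simp add: adist_def)
  then have "gdist (corona G H) (v, a) (i, Some y) = ?f (v, a)"
    by (intro gdist_eqI[where f = ?f] C desc arc assms(3))
  then show ?thesis by (simp only: prod.case)
qed

text \<open>Join a walk from \<open>x\<close> to a fixed hub with the reverse of one from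
  \<open>y\<close>.\<close>

lemma connected_corona: "connected (with_proj (corona G H))"
proof -
  have C: "pair_graph (corona G H)" using G H by (intro pair_graph_corona)
  obtain i where i: "i \<in> pverts G" using G by (auto simp: connected_iff_relpow)
  have "\<exists>n. (x, y) \<in> parcs (corona G H) ^^ n"
    if xy: "x \<in> pverts (corona G H)" "y \<in> pverts (corona G H)" for x y
  proof -
    obtain m n where "(x, (i, None)) \<in> parcs (corona G H) ^^ m"
      "(y, (i, None)) \<in> parcs (corona G H) ^^ n"
      using corona_hub_relpow_gdist(1)[OF i] xy by (metis surj_pair)
    moreover have "sym (parcs (corona G H))" using C by (simp add: pair_graph_iff)
    ultimately have "(x, y) \<in> parcs (corona G H) ^^ (m + n)"
      by (auto simp: relpow_add dest: relpow_sym)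
    then show ?thesis ..
  qed
  moreover have "pverts (corona G H) \<noteq> {}" using i by (auto simp: pverts_corona)
  ultimately show ?thesis using C by (simp add: connected_iff_relpow)
qed

text \<open>Hubs and vertices of other copies are equidistant from the whole copy at
  \<open>v\<close>, so a landmark separating two of its vertices lies in that copy, where distances
  are \<open>adist\<close>.\<close>

lemma adj_resolving_copy:
  assumes "resolving_set (corona G H) S" "v \<in> pverts G"
  shows "adj_resolving H {x. (v, Some x) \<in> S}"
  unfolding adj_resolving_def
proof (intro conjI ballI impI)
  have S: "S \<subseteq> pverts (corona G H)" using assms by (simp add: resolving_set_def)
  then show "{x. (v, Some x) \<in> S} \<subseteq> pverts H" by (auto simp: pverts_corona)
  fix x y assume xy: "x \<in> pverts H" "y \<in> pverts H" "x \<noteq> y"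
  then have xyC: "(v, Some x) \<in> pverts (corona G H)" "(v, Some y) \<in> pverts (corona G H)"
    using assms(2) by (auto simp: pverts_corona)
  then obtain s where s: "s \<in> S"
    "gdist (corona G H) (v, Some x) s \<noteq> gdist (corona G H) (v, Some y) s"
    using assms(1) xy(3) unfolding resolving_set_iff by blast
  then have "s \<in> pverts (corona G H)" using S by blast
  moreover have "snd s \<noteq> None"
    using s calculation xyC by (cases s) (auto simp: pverts_corona corona_hub_relpow_gdist(2))
  ultimately obtain i z where iz: "s = (i, Some z)" "i \<in> pverts G" "z \<in> pverts H"
    by (auto simp: pverts_corona)
  with s xyC have "i = v \<and> adist H x z \<noteq> adist H y z"
    by (auto simp: gdist_corona_copy split: if_splits)
  with s iz show "\<exists>s\<in>{x. (v, Some x) \<in> S}. adist H x s \<noteq> adist H y s" by auto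
qed

text \<open>The traces of \<open>S\<close> on the copies are disjoint, and each has at least
  \<open>adj_dim H\<close> elements.\<close>

lemma adj_dim_le_resolving:
  assumes "resolving_set (corona G H) S"
  shows "card (pverts G) * adj_dim H \<le> card S"
proof -
  let ?T = "\<lambda>v. {x. (v, Some x) \<in> S}"
  have S: "S \<subseteq> pverts (corona G H)" using assms by (simp add: resolving_set_def)
  have "pair_graph (corona G H)" using G H by (intro pair_graph_corona)
  then have finS: "finite S" using S by (auto simp: pair_graph_iff intro: finite_subset)
  have finT: "finite (?T v)" for v
    using finite_vimageI[OF finS, of "\<lambda>x. (v, Some x)"] by (simp add: inj_def vimage_def)
  have finG: "finite (pverts G)" using G by (simp add: pair_graph_iff)
  have "card (pverts G) * adj_dim H = (\<Sum>v\<in>pverts G. adj_dim H)" by simp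
  also have "\<dots> \<le> (\<Sum>v\<in>pverts G. card (?T v))"
    unfolding adj_dim_def using adj_resolving_copy[OF assms]
    by (intro sum_mono Least_le) blast
  also have "\<dots> = card (Sigma (pverts G) ?T)" using finG finT by simp
  also have "\<dots> = card (map_prod id Some ` Sigma (pverts G) ?T)"
    by (intro card_image[symmetric]) (auto simp: inj_on_def)
  also have "\<dots> \<le> card S" using finS by (intro card_mono) auto
  finally show ?thesis .
qed

text \<open>A hub is at distance \<open>1\<close> from every landmark of its copy, so the assumption
  \<open>undominated\<close> is what separates it from the vertices of that copy.\<close>

lemma resolving_set_corona_copies:
  assumes S: "adj_resolving H S"
    and undominated: "\<And>x. x \<in> pverts H \<Longrightarrow> \<exists>s\<in>S. adist H x s \<noteq> 1"
    and ne: "pverts H \<noteq> {}"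
  shows "resolving_set (corona G H) (pverts G \<times> Some ` S)"
proof -
  let ?C = "corona G H" and ?D = "gdist (corona G H)"
  have SH: "S \<subseteq> pverts H" using S by (simp add: adj_resolving_def)
  have pos: "gdist G u v > 0" if "u \<in> pverts G" "v \<in> pverts G" "u \<noteq> v" for u v
    using gdist_descent[OF G that] by auto
  obtain s0 where s0: "s0 \<in> S" using undominated ne by blast
  have le2: "adist H x y \<le> 2" for x y by (simp add: adist_def)
  have "\<exists>s\<in>pverts G \<times> Some ` S. ?D (u, a) s \<noteq> ?D (v, b) s"
    if uv: "(u, a) \<in> pverts ?C" "(v, b) \<in> pverts ?C" "(u, a) \<noteq> (v, b)" for u a v b
  proof (cases "u = v")
    \<comment> \<open>For distinct hubs a landmark over \<open>u\<close> or \<open>v\<close>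
      suffices. If one of the two vertices is a hub, take the landmark over it: it is at distance
      \<open>1\<close>, the other vertex at distance at least \<open>2\<close>. If both lie in
      copies, the distances are at most \<open>2\<close> and at least \<open>3\<close>.\<close>
    case False
    have G': "u \<in> pverts G" "v \<in> pverts G" using uv by (auto simp: pverts_corona)
    show ?thesis
    proof (cases a)
      case None
      then have "?D (u, a) (u, Some s0) \<noteq> ?D (v, b) (u, Some s0)"
        using uv G' False s0 SH pos[of v u] G
        by (auto simp: gdist_corona_copy split: option.splits)
      then show ?thesis using G' s0 by blast
    next
      case a: (Some x)
      show ?thesis
      proof (cases b)
        case None
        then have "?D (u, a) (v, Some s0) \<noteq> ?D (v, b) (v, Some s0)"
          using uv G' False s0 SH pos[of u v] G
          by (auto simp: gdist_corona_copy split: option.splits)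
        then show ?thesis using G' s0 by blast
      next
        case (Some y)
        then have "?D (u, a) (u, Some s0) \<noteq> ?D (v, b) (u, Some s0)"
          using uv G' False s0 SH pos[of v u] a le2[of x s0]
          by (auto simp: gdist_corona_copy split: option.splits)
        then show ?thesis using G' s0 by blast
      qed
    qed
  next
    case True
    have G': "v \<in> pverts G" using uv by (auto simp: pverts_corona)
    have "\<exists>s\<in>S. ?D (v, a) (v, Some s) \<noteq> ?D (v, b) (v, Some s)"
    proof (cases a)
      case None
      then obtain y where y: "b = Some y" "y \<in> pverts H" using uv True by (auto simp: pverts_corona)
      then obtain s where "s \<in> S" "adist H y s \<noteq> 1" using undominated by blast
      then show ?thesis using None y uv G' SH G True
        by (intro bexI[of _ s]) (auto simp: gdist_corona_copy)
    next
      case a: (Some x)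
      then have x: "x \<in> pverts H" using uv by (auto simp: pverts_corona)
      show ?thesis
      proof (cases b)
        case None
        obtain s where "s \<in> S" "adist H x s \<noteq> 1" using undominated x by blast
        then show ?thesis using None a uv G' SH G True
          by (intro bexI[of _ s]) (auto simp: gdist_corona_copy)
      next
        case (Some y)
        then have "y \<in> pverts H" "x \<noteq> y" using uv True a by (auto simp: pverts_corona)
        then obtain s where "s \<in> S" "adist H x s \<noteq> adist H y s"
          using S x unfolding adj_resolving_def by blast
        then show ?thesis using Some a uv G' SH G True
          by (intro bexI[of _ s]) (auto simp: gdist_corona_copy)
      qed
    qed
    then show ?thesis using True G' by blast
  qed
  moreover have "pverts G \<times> Some ` S \<subseteq> pverts ?C" using SH by (auto simp: pverts_corona)
  ultimately show ?thesis unfolding resolving_set_iff by (metis surj_pair)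
qed

text \<open>Placing a minimum adjacency resolving set in every copy attains the lower bound. The
  result depends on \<open>G\<close> only through its order.\<close>

lemma metric_dim_corona:
  assumes undominated: "\<And>S x. adj_resolving H S \<Longrightarrow> x \<in> pverts H \<Longrightarrow> \<exists>s\<in>S. adist H x s \<noteq> 1"
    and ne: "pverts H \<noteq> {}"
  shows "metric_dim (corona G H) = card (pverts G) * adj_dim H"
proof -
  \<comment> \<open>Some adjacency resolving set exists, so the minimum in \<open>adj_dim\<close> is
    attained.\<close>
  have "adj_resolving H (pverts H)"
    unfolding adj_resolving_def by (auto simp: adist_def)
  then have "\<exists>m. \<exists>S. adj_resolving H S \<and> card S = m" by blast
  then have "\<exists>S. adj_resolving H S \<and> card S = adj_dim H"
    unfolding adj_dim_def by (rule LeastI_ex)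
  then obtain S where S: "adj_resolving H S" "card S = adj_dim H" by blast
  have "resolving_set (corona G H) (pverts G \<times> Some ` S)"
    using resolving_set_corona_copies S undominated ne by blast
  moreover have "card (pverts G \<times> Some ` S) = card (pverts G) * adj_dim H"
    using S by (simp add: card_cartesian_product card_image)
  ultimately show ?thesis
    unfolding metric_dim_def using adj_dim_le_resolving
    by (intro Least_equality) blast+
qed

end

section \<open>Adjacency resolving sets are not dominated by a vertex\<close>

text \<open>Distances are estimated through \<open>x\<close>: of two distinct vertices at most one
  is exceptional, giving \<open>2 + 3\<close>.\<close>

lemma gdist_le_5_if_dominated:
  assumes H: "pair_graph H" "connected (with_proj H)"
    and S: "adj_resolving H S" and x: "x \<in> pverts H" and dom: "\<And>s. s \<in> S \<Longrightarrow> adist H x s = 1"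
    and uv: "u \<in> pverts H" "v \<in> pverts H"
  shows "gdist H u v \<le> 5"
proof -
  \<comment> \<open>\<open>S\<close> does not separate two vertices at truncated distance \<open>2\<close> from all of it.\<close>
  define far where "far w \<longleftrightarrow> (\<forall>s\<in>S. adist H w s = 2)" for w
  have SH: "S \<subseteq> pverts H" using S by (simp add: adj_resolving_def)
  have far_unique: "w = w'" if "w \<in> pverts H" "w' \<in> pverts H" "far w" "far w'" for w w'
    using that S unfolding adj_resolving_def far_def by metis
  have arcV: "p \<in> pverts H" "q \<in> pverts H" "p \<noteq> q" if "(p, q) \<in> parcs H" for p q
    using that H by (auto simp: pair_graph_iff irrefl_def)
  have sx: "gdist H s x \<le> 1" if "s \<in> S" for s
  proof -
    have "(s, x) \<in> parcs H"
      using dom[OF that] H by (auto simp: adist_def pair_graph_iff dest: symD split: if_splits)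
    then show ?thesis using gdist_arc_le[OF H _ x, of s x] x H by simp
  qed
  have near: "gdist H w x \<le> 2" if "w \<in> pverts H" "\<not> far w" for w
  proof -
    from that obtain s where s: "s \<in> S" "w = s \<or> (w, s) \<in> parcs H"
      by (auto simp: far_def adist_def split: if_splits)
    then show ?thesis using sx[OF s(1)] gdist_arc_le[OF H _ x, of w s] by force
  qed
  have all: "gdist H w x \<le> 3" if w: "w \<in> pverts H" for w
  proof (cases "w = x")
    case True
    then show ?thesis using H x by simp
  next
    case False
    then obtain z where z: "(w, z) \<in> parcs H" "gdist H w x = Suc (gdist H z x)"
      using gdist_descent[OF H w x] by blast
    show ?thesis
    proof (cases "far w")
      case True
      \<comment> \<open>The next vertex \<open>z\<close> towards \<open>x\<close> differs from the
        unique exceptional vertex \<open>w\<close>, so it is within \<open>2\<close> of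
        \<open>x\<close>.\<close>
      then have "\<not> far z" using far_unique arcV[OF z(1)] by blast
      then show ?thesis using near[of z] z arcV[OF z(1)] by simp
    qed (use near[OF w] in simp)
  qed
  show ?thesis
  proof (cases "u = v")
    case False
    then have "\<not> far u \<or> \<not> far v" using far_unique uv by blast
    then have "gdist H u x + gdist H v x \<le> 5"
      using near[of u] near[of v] all[of u] all[of v] uv by auto
    then show ?thesis
      using gdist_triangle[OF H uv(1) x uv(2)] gdist_commute[OF H x uv(2)] by simp
  qed (use H uv in simp)
qed

lemma diameter_le:
  assumes "pair_graph H" "pverts H \<noteq> {}"
    and "\<And>u v. u \<in> pverts H \<Longrightarrow> v \<in> pverts H \<Longrightarrow> gdist H u v \<le> d"
  shows "diameter H \<le> d"
proof -
  have "{gdist H u v | u v. u \<in> pverts H \<and> v \<in> pverts H}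
      = (\<lambda>(u, v). gdist H u v) ` (pverts H \<times> pverts H)" by auto
  then show ?thesis
    using assms unfolding diameter_def by (auto simp: pair_graph_iff)
qed

text \<open>All of \<open>S\<close> is adjacent to \<open>x\<close>, so it has at most two elements.
  The count is one exceptional vertex, \<open>x\<close> itself, and for each \<open>s\<close> in
  \<open>S\<close> at most two vertices: \<open>s\<close> and one further neighbour.\<close>

lemma card_le_if_dominated:
  assumes H: "pair_graph H" and deg: "\<And>v. v \<in> pverts H \<Longrightarrow> card {w. (v, w) \<in> parcs H} \<le> 2"
    and S: "adj_resolving H S" and x: "x \<in> pverts H" and dom: "\<And>s. s \<in> S \<Longrightarrow> adist H x s = 1"
  shows "card (pverts H) \<le> 6"
proof -
  let ?N = "\<lambda>v. {w. (v, w) \<in> parcs H}"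
  define far where "far = {w \<in> pverts H. \<forall>s\<in>S. adist H w s = 2}"
  have SH: "S \<subseteq> pverts H" using S by (simp add: adj_resolving_def)
  have fin: "finite (pverts H)" using H by (simp add: pair_graph_iff)
  have finN: "finite (?N v)" for v
    using H by (auto intro: finite_subset[OF _ fin] simp: pair_graph_iff)
  have finS: "finite S" using SH fin finite_subset by blast
  have sym: "(p, q) \<in> parcs H \<Longrightarrow> (q, p) \<in> parcs H" for p q
    using H by (auto simp: pair_graph_iff dest: symD)
  have xs: "(x, s) \<in> parcs H" if "s \<in> S" for s
    using dom[OF that] by (auto simp: adist_def split: if_splits)
  have "card S \<le> card (?N x)" using xs finN by (intro card_mono) auto
  then have cardS: "card S \<le> 2" using deg[OF x] by simp
  have far: "card far \<le> 1"
  proof -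
    have "w = w'" if "w \<in> far" "w' \<in> far" for w w'
      using that S unfolding adj_resolving_def far_def by (metis (mono_tags, lifting) mem_Collect_eq)
    then show ?thesis using fin by (auto simp: far_def card_le_Suc0_iff_eq)
  qed
  have one: "card (insert s (?N s - {x})) \<le> 2" if "s \<in> S" for s
  proof -
    \<comment> \<open>One of the at most two neighbours of \<open>s\<close> is
      \<open>x\<close>.\<close>
    have "card (?N s - {x}) \<le> 1"
      using deg[of s] sym[OF xs[OF that]] that SH finN by auto
    then show ?thesis using finN by (auto simp: card_insert_if)
  qed
  have "pverts H \<subseteq> far \<union> {x} \<union> (\<Union>s\<in>S. insert s (?N s - {x}))"
    by (auto simp: far_def adist_def dest: sym split: if_splits)
  then have "card (pverts H) \<le> card (far \<union> {x} \<union> (\<Union>s\<in>S. insert s (?N s - {x})))"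
    using fin finS finN by (intro card_mono) (auto simp: far_def)
  also have "\<dots> \<le> card far + card {x} + card (\<Union>s\<in>S. insert s (?N s - {x}))"
    by (meson add_le_mono1 card_Un_le le_trans)
  also have "card (\<Union>s\<in>S. insert s (?N s - {x})) \<le> (\<Sum>s\<in>S. card (insert s (?N s - {x})))"
    using finS by (rule card_UN_le)
  also have "\<dots> \<le> (\<Sum>s\<in>S. 2)" using one by (rule sum_mono)
  finally show ?thesis using far cardS by simp
qed

section \<open>Degrees in cycle graphs\<close>

lemma cycle_graph_degree: "card {j. (i, j) \<in> parcs (cycle_graph n)} \<le> 2"
proof -
  \<comment> \<open>Adding \<open>n\<close> before subtracting avoids truncated subtraction at
    \<open>i = 0\<close>.\<close>
  have "j = (i + n - 1) mod n" if "i = (j + 1) mod n" "j < n" for j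
  proof (cases "j + 1 = n")
    case True
    then show ?thesis using that by auto
  next
    case False
    then have "i = j + 1" using that by simp
    then show ?thesis using that by simp
  qed
  then have "{j. (i, j) \<in> parcs (cycle_graph n)} \<subseteq> {(i + 1) mod n, (i + n - 1) mod n}"
    by (auto simp: cycle_graph_def)
  then have "card {j. (i, j) \<in> parcs (cycle_graph n)} \<le> card {(i + 1) mod n, (i + n - 1) mod n}"
    by (intro card_mono) auto
  also have "\<dots> \<le> 2" by (simp add: card_insert_if)
  finally show ?thesis .
qed

lemma out_degree_with_proj: "out_degree (with_proj H) v = card {w. (v, w) \<in> parcs H}"
proof -
  have "out_arcs (with_proj H) v = Pair v ` {w. (v, w) \<in> parcs H}"
    by (auto simp: out_arcs_def)
  then show ?thesis by (simp add: out_degree_def card_image inj_on_def)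
qed

text \<open>Out-degrees are invariant under isomorphism, so the bound transfers from the standard
  cycle.\<close>

lemma is_cycle_graph_degree:
  assumes "is_cycle_graph H" "v \<in> pverts H"
  shows "card {w. (v, w) \<in> parcs H} \<le> 2"
proof -
  obtain n f where f: "pre_digraph.digraph_isomorphism (with_proj H) f"
    "with_proj (cycle_graph n) = app_iso f (with_proj H)"
    using assms unfolding is_cycle_graph_def digraph_iso_def by blast
  then interpret wf_digraph "with_proj H"
    by (simp add: pre_digraph.digraph_isomorphism_def)
  have "out_degree (with_proj (cycle_graph n)) (iso_verts f v) = out_degree (with_proj H) v"
    using out_degree_app_iso_eq[OF f(1)] assms(2) f(2) by simp
  then show ?thesis
    using cycle_graph_degree[of "iso_verts f v" n] by (simp add: out_degree_with_proj)
qed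

text \<open>A dominating \<open>x\<close> would force diameter at most \<open>5\<close>, and order
  at most \<open>6\<close> in a cycle.\<close>

lemma adj_resolving_undominated:
  assumes "pair_graph H" "connected (with_proj H)" "card (pverts H) \<ge> 7"
    and "diameter H \<ge> 6 \<or> is_cycle_graph H"
    and "adj_resolving H S" "x \<in> pverts H"
  shows "\<exists>s\<in>S. adist H x s \<noteq> 1"
proof (rule ccontr)
  assume "\<not> ?thesis"
  then have dom: "adist H x s = 1" if "s \<in> S" for s using that by blast
  from assms(4) show False
  proof
    assume "diameter H \<ge> 6"
    moreover have "diameter H \<le> 5"
      using assms dom by (intro diameter_le gdist_le_5_if_dominated[of H S x]) auto
    ultimately show False by simp
  next
    assume "is_cycle_graph H"
    then have "card (pverts H) \<le> 6"
      using is_cycle_graph_degree assms dom by (intro card_le_if_dominated[of H S x]) auto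
    with assms(3) show False by simp
  qed
qed

section \<open>Iterated corona products\<close>

lemma connected_corona_iter:
  assumes "pair_graph G" "connected (with_proj G)" "pair_graph H"
  shows "connected (with_proj (corona_iter k G H))"
proof (induction k)
  case 0
  then show ?case using assms by (auto intro!: connected_relabel simp: inj_def)
next
  case (Suc k)
  then show ?case
    using assms
    by (auto intro!: connected_relabel connected_corona inj_corona_iter_rename
        pair_graph_corona pair_graph_corona_iter)
qed

lemma card_pverts_relabel:
  assumes "inj f"
  shows "card (pverts (relabel f G)) = card (pverts G)"
  using assms by (simp add: relabel_def card_image inj_on_subset[OF _ subset_UNIV])

lemma card_pverts_corona_iter:
  assumes "pair_graph H"
  shows "card (pverts (corona_iter k G H)) = card (pverts G) * (card (pverts H) + 1) ^ k"
proof (induction k)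
  case 0
  then show ?case by (simp add: card_pverts_relabel inj_def)
next
  case (Suc k)
  then show ?case
    using assms
    by (simp add: card_pverts_relabel[OF inj_corona_iter_rename] card_pverts_corona algebra_simps)
qed

theorem theorem13:
  fixes G :: "'a pair_pre_digraph" and H :: "'b pair_pre_digraph" and n\<^sub>1 n\<^sub>2 k :: nat
  assumes "pair_graph G" and "connected (with_proj G)"
    and "card (pverts G) = n\<^sub>1" and "n\<^sub>1 \<ge> 2"
    and "pair_graph H" and "connected (with_proj H)"
    and "card (pverts H) = n\<^sub>2" and "n\<^sub>2 \<ge> 7"
    and "diameter H \<ge> 6 \<or> is_cycle_graph H"
    and "k \<ge> 1"
  shows "metric_dim (corona_iter k G H) = n\<^sub>1 * (n\<^sub>2 + 1) ^ (k - 1) * metric_dim (corona K1 H)"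
proof -
  have ne: "pverts H \<noteq> {}" using assms by auto
  have undominated: "\<exists>s\<in>S. adist H x s \<noteq> 1" if "adj_resolving H S" "x \<in> pverts H" for S x
    using assms that by (intro adj_resolving_undominated) auto
  have K1: "pair_graph K1" by (auto simp: pair_graph_iff K1_def sym_def irrefl_def)
  have "connected (with_proj K1)"
    unfolding connected_iff_relpow[OF K1] by (auto simp: K1_def intro: exI[of _ 0])
  \<comment> \<open>The corona formula for a graph of order \<open>1\<close> identifies the
    constant.\<close>
  then have "metric_dim (corona K1 H) = adj_dim H"
    using metric_dim_corona[OF K1 _ assms(5) undominated ne] by (simp add: K1_def)
  \<comment> \<open>Only the last corona step needs the dimension formula; the first
    \<open>m = k - 1\<close> steps contribute the order of the base graph \<open>?G\<close>.\<close>
  moreover obtain m where k: "k = Suc m" using assms by (cases k) auto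
  let ?G = "corona_iter m G H"
  have G: "pair_graph ?G" "connected (with_proj ?G)"
    using assms by (auto intro: pair_graph_corona_iter connected_corona_iter)
  have "metric_dim (corona_iter k G H) = metric_dim (corona ?G H)"
    using k G assms by (simp add: metric_dim_relabel[OF _ inj_corona_iter_rename] pair_graph_corona)
  moreover have "\<dots> = card (pverts ?G) * adj_dim H"
    using metric_dim_corona[OF G assms(5) undominated ne] by simp
  ultimately show ?thesis
    using assms k by (simp add: card_pverts_corona_iter)
qed

end
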